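(* Let $N>0$ and $L\in\mathbb{Z}_{\ge2}$. Then $\overline{C}_{L-1}(N)\ge\frac12\ln\frac{L-1}{4\pi eLN}$.
   Context: For $x_1,\dots,x_L\in\mathbb{R}^n$ with centroid $\bar x=\frac1L\sum_ix_i$, $\overline{\mathrm{rad}}^2(x_1,\dots,x_L)=\frac1L\sum_i\|x_i-\bar x\|_2^2$. A set $\mathcal{C}\subseteq\mathbb{R}^n$ is an $(N,L-1)$-average-radius list-decodable code if every $L$ distinct points of $\mathcal{C}$ have $\overline{\mathrm{rad}}^2>nN$. Its rate is $R(\mathcal{C})=\limsup_{K\to\infty}\frac1n\ln\frac{|\mathcal{C}\cap K\mathcal{A}|}{\mathrm{vol}(K\mathcal{A})}$, where $\mathcal{A}$ is an arbitrary centrally symmetric connected compact set in $\mathbb{R}^n$ with nonempty interior (e.g. the unit ball). $\overline{C}_{L-1}(N)=\limsup_{n\to\infty}\sup R(\mathcal{C})$ over all such codes in $\mathbb{R}^n$. *)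

theory Defs
  imports "HOL-Analysis.Analysis"
begin

definition Rn :: "nat \<Rightarrow> (nat \<Rightarrow> real) set" where
  "Rn n = PiE {..<n} (\<lambda>_. UNIV)"

definition lebRn :: "nat \<Rightarrow> (nat \<Rightarrow> real) measure" where
  "lebRn n = PiM {..<n} (\<lambda>_. lborel)"

definition sqdist :: "nat \<Rightarrow> (nat \<Rightarrow> real) \<Rightarrow> (nat \<Rightarrow> real) \<Rightarrow> real" where
  "sqdist n x y = (\<Sum>i<n. (x i - y i)^2)"

definition centroid :: "nat \<Rightarrow> (nat \<Rightarrow> real) set \<Rightarrow> (nat \<Rightarrow> real)" where
  "centroid n S = (\<lambda>i\<in>{..<n}. (\<Sum>x\<in>S. x i) / real (card S))"

definition avg_rad2 :: "nat \<Rightarrow> (nat \<Rightarrow> real) set \<Rightarrow> real" where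
  "avg_rad2 n S = (\<Sum>x\<in>S. sqdist n x (centroid n S)) / real (card S)"

text \<open>(N, L-1)-average-radius list-decodable code in R^n: every L distinct
  points have average squared radius > n N.\<close>
definition avg_rad_list_dec_code ::
    "nat \<Rightarrow> real \<Rightarrow> nat \<Rightarrow> (nat \<Rightarrow> real) set \<Rightarrow> bool" where
  "avg_rad_list_dec_code n N L C \<longleftrightarrow>
     C \<subseteq> Rn n \<and> (\<forall>S. S \<subseteq> C \<and> card S = L \<longrightarrow> avg_rad2 n S > real n * N)"

definition scaleRn :: "nat \<Rightarrow> real \<Rightarrow> (nat \<Rightarrow> real) set \<Rightarrow> (nat \<Rightarrow> real) set" where
  "scaleRn n K A = (\<lambda>x. \<lambda>i\<in>{..<n}. K * x i) ` A"

definition admissible_shape :: "nat \<Rightarrow> (nat \<Rightarrow> real) set \<Rightarrow> bool" where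
  "admissible_shape n A \<longleftrightarrow>
     A \<subseteq> Rn n \<and> (\<forall>x\<in>A. (\<lambda>i\<in>{..<n}. - x i) \<in> A) \<and> connected A \<and> compact A \<and>
     (\<exists>U. openin (top_of_set (Rn n)) U \<and> U \<noteq> {} \<and> U \<subseteq> A)"

definition eln :: "real \<Rightarrow> ereal" where
  "eln x = (if x > 0 then ereal (ln x) else -\<infinity>)"

definition code_rate :: "nat \<Rightarrow> (nat \<Rightarrow> real) set \<Rightarrow> (nat \<Rightarrow> real) set \<Rightarrow> ereal" where
  "code_rate n A C = Limsup at_top (\<lambda>K::real.
      ereal (1 / real n) *
      eln (real (card (C \<inter> scaleRn n K A)) / measure (lebRn n) (scaleRn n K A)))"

definition avg_list_dec_capacity ::
    "real \<Rightarrow> nat \<Rightarrow> (nat \<Rightarrow> (nat \<Rightarrow> real) set) \<Rightarrow> ereal" where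
  "avg_list_dec_capacity N L A =
     limsup (\<lambda>n. SUP C\<in>{C. avg_rad_list_dec_code n N L C}. code_rate n (A n) C)"

end

theory Submission
  imports Defs "HOL-Probability.Distributions"
begin

text \<open>The squared average radius of \<open>L\<close> points is \<open>1 / (2 L\<^sup>2)\<close> times the sum of all squared mutual
  distances, so a code with squared minimum distance above \<open>n s\<close>, where \<open>s = 2 L N / (L - 1)\<close>, is
  list-decodable. By the Gilbert-Varshamov argument a maximal packing with this distance has density
  at least the inverse volume of a ball of squared radius \<open>n s\<close>, and comparison with a Gaussian
  density of variance \<open>s\<close> bounds that volume by \<open>(2 \<pi> e s)\<close> to the power \<open>n / 2\<close>.\<close>

section \<open>Average radius in terms of mutual distances\<close>

lemma sum_sq_dev_mean:
  fixes f :: "'a \<Rightarrow> real"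
  assumes "finite S" "S \<noteq> {}"
  shows "(\<Sum>x\<in>S. (f x - (\<Sum>y\<in>S. f y) / real (card S))\<^sup>2)
       = (\<Sum>x\<in>S. \<Sum>y\<in>S. (f x - f y)\<^sup>2) / (2 * real (card S))"
proof -
  define l where "l = real (card S)"
  define a where "a = (\<Sum>y\<in>S. f y)"
  define b where "b = (\<Sum>y\<in>S. (f y)\<^sup>2)"
  have l: "l > 0" using assms by (simp add: l_def card_gt_0_iff)
  \<comment> \<open>Expanding the squares turns the left side into \<open>b - a\<^sup>2 / l\<close>
    and the double sum into \<open>2 * (l * b - a\<^sup>2)\<close>.\<close>
  have "(\<Sum>x\<in>S. (f x - a / l)\<^sup>2) = (\<Sum>x\<in>S. (f x)\<^sup>2 - 2 * (a / l) * f x + (a / l)\<^sup>2)"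
    by (intro sum.cong refl) (simp add: power2_diff)
  also have "\<dots> = b - 2 * (a / l) * a + l * (a / l)\<^sup>2"
    by (simp only: sum.distrib sum_subtractf sum_distrib_left[symmetric] a_def b_def l_def sum_constant)
  also have "\<dots> = b - a\<^sup>2 / l" using l by (simp add: field_simps power2_eq_square)
  finally have 1: "(\<Sum>x\<in>S. (f x - a / l)\<^sup>2) = b - a\<^sup>2 / l" .
  have "(\<Sum>x\<in>S. \<Sum>y\<in>S. (f x - f y)\<^sup>2) = (\<Sum>x\<in>S. \<Sum>y\<in>S. (f x)\<^sup>2 + (f y)\<^sup>2 - 2 * f x * f y)"
    by (intro sum.cong refl) (simp add: power2_diff)
  also have "\<dots> = (\<Sum>x\<in>S. l * (f x)\<^sup>2 + b - 2 * f x * a)"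
    by (simp only: sum.distrib sum_subtractf sum_distrib_left[symmetric] a_def b_def l_def sum_constant)
  also have "\<dots> = l * b + l * b - 2 * (a * a)"
    by (simp only: sum.distrib sum_subtractf sum_distrib_left[symmetric] sum_distrib_right[symmetric]
        a_def b_def l_def sum_constant mult.assoc)
  finally have 2: "(\<Sum>x\<in>S. \<Sum>y\<in>S. (f x - f y)\<^sup>2) = l * b + l * b - 2 * (a * a)" .
  show ?thesis
    unfolding l_def[symmetric] a_def[symmetric] 1 2 using l by (simp add: field_simps power2_eq_square)
qed

lemma avg_rad2_eq_pairwise:
  assumes "finite S" "S \<noteq> {}"
  shows "avg_rad2 n S = (\<Sum>x\<in>S. \<Sum>y\<in>S. sqdist n x y) / (2 * (real (card S))\<^sup>2)"
proof -
  have "(\<Sum>x\<in>S. sqdist n x (centroid n S))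
      = (\<Sum>i<n. \<Sum>x\<in>S. (x i - (\<Sum>y\<in>S. y i) / real (card S))\<^sup>2)"
    unfolding sqdist_def centroid_def by (subst sum.swap) simp
  also have "\<dots> = (\<Sum>i<n. (\<Sum>x\<in>S. \<Sum>y\<in>S. (x i - y i)\<^sup>2) / (2 * real (card S)))"
    by (intro sum.cong refl sum_sq_dev_mean[OF assms])
  also have "\<dots> = (\<Sum>i<n. \<Sum>x\<in>S. \<Sum>y\<in>S. (x i - y i)\<^sup>2) / (2 * real (card S))"
    by (simp add: sum_divide_distrib)
  also have "(\<Sum>i<n. \<Sum>x\<in>S. \<Sum>y\<in>S. (x i - y i)\<^sup>2) = (\<Sum>x\<in>S. \<Sum>y\<in>S. sqdist n x y)"
    unfolding sqdist_def by (subst sum.swap, rule sum.cong[OF refl], rule sum.swap)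
  finally show ?thesis
    by (simp add: avg_rad2_def power2_eq_square)
qed

text \<open>With \<open>l = card S\<close>, each of the \<open>l * (l - 1)\<close> ordered pairs of
  distinct points contributes more than \<open>d\<close> to the double sum, which is then divided by
  \<open>2 * l\<^sup>2\<close>; the diagonal contributes 0.\<close>

lemma avg_rad2_gt_of_separated:
  assumes "card S \<ge> 2" "pairwise (\<lambda>x y. d < sqdist n x y) S"
  shows "avg_rad2 n S > (real (card S) - 1) / (2 * real (card S)) * d"
proof -
  define l where "l = real (card S)"
  have fin: "finite S" using assms(1) by (rule_tac ccontr) simp
  have ne: "S \<noteq> {}" using assms(1) by auto
  have l: "l \<ge> 2" using assms(1) by (simp add: l_def)
  have row: "(\<Sum>y\<in>S. sqdist n x y) > (l - 1) * d" if "x \<in> S" for x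
  proof -
    have c: "card (S - {x}) = card S - 1" using that fin by simp
    have "(l - 1) * d = (\<Sum>y\<in>S - {x}. d)"
      using c assms(1) by (simp add: l_def of_nat_diff)
    also have "\<dots> < (\<Sum>y\<in>S - {x}. sqdist n x y)"
    proof (rule sum_strict_mono)
      show "S - {x} \<noteq> {}" using c assms(1) by (metis One_nat_def card.empty diff_is_0_eq not_less_eq_eq numeral_2_eq_2)
    qed (use fin assms(2) that in \<open>auto simp: pairwise_def\<close>)
    also have "\<dots> = (\<Sum>y\<in>S. sqdist n x y)"
      using fin that by (simp add: sum.remove[of S x] sqdist_def)
    finally show ?thesis .
  qed
  have "l * ((l - 1) * d) = (\<Sum>x\<in>S. (l - 1) * d)" by (simp add: l_def)
  also have "\<dots> < (\<Sum>x\<in>S. \<Sum>y\<in>S. sqdist n x y)"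
    using fin ne row by (rule sum_strict_mono)
  finally have *: "l * ((l - 1) * d) < (\<Sum>x\<in>S. \<Sum>y\<in>S. sqdist n x y)" .
  have "(l - 1) / (2 * l) * d = l * ((l - 1) * d) / (2 * l\<^sup>2)"
    using l by (simp add: field_simps power2_eq_square)
  also have "\<dots> < (\<Sum>x\<in>S. \<Sum>y\<in>S. sqdist n x y) / (2 * l\<^sup>2)"
    using * l by (intro divide_strict_right_mono) auto
  finally show ?thesis
    using avg_rad2_eq_pairwise[OF fin ne] by (simp add: l_def)
qed

section \<open>Volume of a ball\<close>

interpretation product_sigma_finite "\<lambda>_::nat. lborel :: real measure"
  by standard

lemma space_lebRn: "space (lebRn n) = Rn n"
  by (simp add: lebRn_def Rn_def space_PiM)

lemma sqdist_measurable [measurable]: "sqdist n c \<in> borel_measurable (lebRn n)"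
  unfolding sqdist_def lebRn_def by measurable

text \<open>On the ball of squared radius \<^term>\<open>real n * s\<close> the Gaussian density with variance \<^term>\<open>s\<close>
  is at least \<^term>\<open>1 / sqrt (2 * pi * exp 1 * s) ^ n\<close>, and its total mass is 1.\<close>
lemma emeasure_ball_le:
  assumes "s > 0"
  shows "emeasure (lebRn n) {x \<in> Rn n. sqdist n c x \<le> real n * s}
         \<le> ennreal (sqrt (2 * pi * exp 1 * s) ^ n)"
proof -
  define V where "V = sqrt (2 * pi * exp 1 * s)"
  define g where "g = (\<lambda>i. normal_density (c i) (sqrt s))"
  have V: "V > 0" using assms by (simp add: V_def)
  let ?B = "{x \<in> Rn n. sqdist n c x \<le> real n * s}"
  have B: "?B \<in> sets (lebRn n)"
    unfolding space_lebRn[symmetric] by measurable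
  \<comment> \<open>The factor \<open>sqrt (exp 1)\<close> in \<open>V\<close> becomes the 1/2 in
    the exponent; summed over the coordinates it gives n/2, which offsets exactly the bound on
    \<open>sqdist n c x / (2 * s)\<close> valid on the ball.\<close>
  have Vg: "V * g i t = exp (1/2 - (c i - t)\<^sup>2 / (2 * s))" for i t
  proof -
    have e: "sqrt (exp 1) = exp (1/2::real)"
      by (rule real_sqrt_unique) (auto simp: power2_eq_square exp_add[symmetric])
    have "V = sqrt (2 * pi * s) * exp (1/2)"
      unfolding V_def e[symmetric] real_sqrt_mult[symmetric] by (simp add: mult_ac)
    moreover have "g i t = exp (- ((c i - t)\<^sup>2 / (2 * s))) / sqrt (2 * pi * s)"
      using assms by (simp add: g_def normal_density_def power2_commute)
    ultimately have "V * g i t = exp (1/2) * exp (- ((c i - t)\<^sup>2 / (2 * s)))"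
      using assms by simp
    then show ?thesis by (simp add: exp_add[symmetric])
  qed
  have ge1: "(\<Prod>i<n. V * g i (x i)) \<ge> 1" if "sqdist n c x \<le> real n * s" for x
  proof -
    have "(\<Prod>i<n. V * g i (x i)) = exp (\<Sum>i<n. 1/2 - (c i - x i)\<^sup>2 / (2 * s))"
      unfolding Vg by (simp add: exp_sum)
    also have "(\<Sum>i<n. 1/2 - (c i - x i)\<^sup>2 / (2 * s)) = real n / 2 - sqdist n c x / (2 * s)"
      by (simp add: sum_subtractf sqdist_def sum_divide_distrib)
    also have "exp \<dots> \<ge> 1"
      using that assms by (simp add: field_simps)
    finally show ?thesis .
  qed
  have "emeasure (lebRn n) ?B = (\<integral>\<^sup>+x. indicator ?B x \<partial>lebRn n)"
    using B by simp
  also have "\<dots> \<le> (\<integral>\<^sup>+x. (\<Prod>i<n. ennreal (V * g i (x i))) \<partial>lebRn n)"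
  proof (rule nn_integral_mono)
    fix x
    have "(\<Prod>i<n. ennreal (V * g i (x i))) = ennreal (\<Prod>i<n. V * g i (x i))"
      using V by (intro prod_ennreal) (auto simp: g_def)
    then show "indicator ?B x \<le> (\<Prod>i<n. ennreal (V * g i (x i)))"
      using ge1[of x] by (auto simp: indicator_def)
  qed
  also have "\<dots> = (\<Prod>i<n. \<integral>\<^sup>+t. ennreal (V * g i t) \<partial>lborel)"
    unfolding lebRn_def by (rule product_nn_integral_prod) (auto simp: g_def)
  also have "\<dots> = (\<Prod>i<n. ennreal V)"
  proof (intro prod.cong refl)
    fix i
    have "(\<integral>\<^sup>+t. ennreal (V * g i t) \<partial>lborel) = ennreal V * (\<integral>\<^sup>+t. ennreal (g i t) \<partial>lborel)"
      using V by (subst nn_integral_cmult[symmetric]) (auto simp: g_def ennreal_mult)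
    also have "(\<integral>\<^sup>+t. ennreal (g i t) \<partial>lborel) = 1"
      using assms by (simp add: g_def nn_integral_eq_integral)
    finally show "(\<integral>\<^sup>+t. ennreal (V * g i t) \<partial>lborel) = ennreal V" by simp
  qed
  also have "\<dots> = ennreal (V ^ n)"
    using V by (simp add: ennreal_power)
  finally show ?thesis by (simp add: V_def)
qed

section \<open>Compact bodies and their dilates\<close>

lemma continuous_coordinate: "continuous_on S (\<lambda>x::nat \<Rightarrow> real. x i)"
  by (rule continuous_on_subset[OF continuous_on_product_coordinates]) simp

text \<open>Compactness refers to the topology of all functions
  \<open>nat \<Rightarrow> real\<close>, whereas \<open>lebRn n\<close> lives on functions equal to
  \<open>undefined\<close> from index n on. The inclusion is measurable because every coordinate is,
  so Borel sets pull back.\<close>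

lemma compact_sets_lebRn:
  assumes "compact B" "B \<subseteq> Rn n"
  shows "B \<in> sets (lebRn n)"
proof -
  have "B \<in> sets borel" using assms(1) by (simp add: borel_compact)
  then have B: "B \<in> sets (PiM UNIV (\<lambda>_::nat. borel :: real measure))"
    by (simp add: sets_PiM_equal_borel)
  have "(\<lambda>x. x i) \<in> measurable (lebRn n) (borel :: real measure)" for i
  proof (cases "i < n")
    case True
    then have "(\<lambda>x. x i) \<in> measurable (lebRn n) (lborel :: real measure)"
      unfolding lebRn_def by (intro measurable_component_singleton) simp
    then show ?thesis by simp
  next
    case False
    then have "x i = undefined" if "x \<in> space (lebRn n)" for x
      using that by (auto simp: space_lebRn Rn_def PiE_def extensional_def)
    then show ?thesis
      by (subst measurable_cong[where g = "\<lambda>_. undefined"]) auto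
  qed
  then have "(\<lambda>x. x) \<in> measurable (lebRn n) (PiM UNIV (\<lambda>_::nat. borel :: real measure))"
    by (intro measurable_PiM_single') auto
  from measurable_sets[OF this B] have "B \<inter> space (lebRn n) \<in> sets (lebRn n)" by simp
  then show ?thesis using assms(2) by (simp add: space_lebRn Int_absorb2)
qed

text \<open>Each coordinate is bounded on a compact set, so the set lies in a box of finite volume.
  Finiteness matters because \<open>measure\<close> is 0 on sets of infinite measure.\<close>

lemma compact_emeasure_lebRn_finite:
  assumes "compact B" "B \<subseteq> Rn n"
  shows "emeasure (lebRn n) B < \<infinity>"
proof -
  have "\<exists>a b. \<forall>x\<in>B. x i \<in> {a..b}" for i
  proof -
    have "bounded ((\<lambda>x. x i) ` B)"
      using assms(1) by (intro compact_imp_bounded compact_continuous_image continuous_coordinate)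
    then obtain M where "\<forall>x\<in>B. \<bar>x i\<bar> \<le> M" unfolding bounded_iff by auto
    then show ?thesis by (intro exI[of _ "-M"] exI[of _ M]) auto
  qed
  then obtain a b where ab: "\<And>i x. x \<in> B \<Longrightarrow> x i \<in> {a i..b i}" by metis
  have "B \<subseteq> PiE {..<n} (\<lambda>i. {a i..b i})"
    using ab assms(2) by (auto simp: Rn_def PiE_iff)
  then have "emeasure (lebRn n) B \<le> emeasure (lebRn n) (PiE {..<n} (\<lambda>i. {a i..b i}))"
    unfolding lebRn_def by (intro emeasure_mono sets_PiM_I_finite) auto
  also have "\<dots> = (\<Prod>i<n. emeasure lborel {a i..b i})"
    unfolding lebRn_def by (rule emeasure_PiM) auto
  also have "\<dots> < \<infinity>"
    by (simp add: less_top[symmetric] ennreal_prod_eq_top emeasure_lborel_Icc_eq)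
  finally show ?thesis .
qed

lemma scaleRn_subset: "scaleRn n K B \<subseteq> Rn n"
  by (auto simp: scaleRn_def Rn_def PiE_iff split: if_splits)

lemma compact_scaleRn:
  assumes "compact B"
  shows "compact (scaleRn n K B)"
  unfolding scaleRn_def
proof (rule compact_continuous_image[OF _ assms], rule continuous_on_coordinatewise_then_product)
  fix i
  show "continuous_on B (\<lambda>x. (\<lambda>i\<in>{..<n}. K * x i) i)"
    by (cases "i < n") (auto intro!: continuous_intros continuous_coordinate)
qed

text \<open>The body contains a box that is open relative to \<open>Rn n\<close>, and dilation by
  \<open>K\<close> multiplies the volume of that box by \<open>K ^ n\<close>. This makes the volume
  of the dilated body positive and, for n > 0, unbounded as \<open>K\<close> grows.\<close>

lemma measure_scaleRn_ge:
  assumes "admissible_shape n B"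
  shows "\<exists>v>0. \<forall>K>0. measure (lebRn n) (scaleRn n K B) \<ge> K ^ n * v"
proof -
  from assms obtain U where U: "openin (top_of_set (Rn n)) U" "U \<noteq> {}" "U \<subseteq> B"
    and B: "B \<subseteq> Rn n" "compact B"
    by (auto simp: admissible_shape_def)
  from U(1) obtain T where T: "open T" "U = Rn n \<inter> T" by (auto simp: openin_open)
  from U(2) T obtain x where x: "x \<in> Rn n" "x \<in> T" by auto
  have "openin (product_topology (\<lambda>i::nat. euclidean :: real topology) UNIV) T"
    using T(1) by (simp add: open_fun_def)
  from product_topology_open_contains_basis[OF this x(2)]
  obtain X where X: "x \<in> PiE UNIV X" "\<And>i. open (X i)" "PiE UNIV X \<subseteq> T"
    by auto
  have "\<exists>e>0. \<forall>t. \<bar>t - x i\<bar> < e \<longrightarrow> t \<in> X i" for i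
    using X(1) X(2)[of i] unfolding open_dist by (auto simp: dist_real_def PiE_iff)
  then obtain e where e: "\<And>i. e i > 0" "\<And>i t. \<bar>t - x i\<bar> < e i \<Longrightarrow> t \<in> X i" by metis
  define v where "v = (\<Prod>i<n. 2 * e i)"
  have v: "v > 0" using e(1) by (simp add: v_def prod_pos)
  have "measure (lebRn n) (scaleRn n K B) \<ge> K ^ n * v" if K: "K > 0" for K
  proof -
    let ?Q = "PiE {..<n} (\<lambda>i. {K * x i - K * e i<..<K * x i + K * e i})"
    have "?Q \<subseteq> scaleRn n K B"
    proof
      fix y assume y: "y \<in> ?Q"
      \<comment> \<open>From index n on \<open>z\<close> copies \<open>x\<close>, so it stays in
        \<open>Rn n\<close> and in the basic neighbourhood of \<open>x\<close>;
        \<open>scaleRn\<close> resets these coordinates.\<close>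
      define z where "z = (\<lambda>i. if i < n then y i / K else x i)"
      have "z i \<in> X i" for i
      proof (rule e(2), cases "i < n")
        case True
        then have "y i \<in> {K * x i - K * e i<..<K * x i + K * e i}"
          using y by (auto simp: PiE_iff)
        then show "\<bar>z i - x i\<bar> < e i"
          using True K by (simp add: z_def abs_less_iff field_simps)
      qed (simp add: z_def e(1))
      moreover have zR: "z \<in> Rn n" using x(1) by (auto simp: z_def Rn_def PiE_iff extensional_def)
      ultimately have "z \<in> B" using X(3) T U(3) by (auto simp: PiE_iff)
      moreover have "y = (\<lambda>i\<in>{..<n}. K * z i)"
        using y K by (auto simp: z_def fun_eq_iff PiE_iff extensional_def)
      ultimately show "y \<in> scaleRn n K B" by (auto simp: scaleRn_def)
    qed
    moreover have m: "scaleRn n K B \<in> fmeasurable (lebRn n)"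
      using compact_scaleRn[OF B(2)] scaleRn_subset
      by (intro fmeasurableI compact_sets_lebRn compact_emeasure_lebRn_finite)
    moreover have "?Q \<in> sets (lebRn n)"
      unfolding lebRn_def by (intro sets_PiM_I_finite) auto
    ultimately have "measure (lebRn n) ?Q \<le> measure (lebRn n) (scaleRn n K B)"
      by (intro measure_mono_fmeasurable)
    moreover have "emeasure (lebRn n) ?Q = ennreal (K ^ n * v)"
    proof -
      have "emeasure (lebRn n) ?Q = (\<Prod>i<n. emeasure lborel {K * x i - K * e i<..<K * x i + K * e i})"
        unfolding lebRn_def by (rule emeasure_PiM) auto
      also have "\<dots> = (\<Prod>i<n. ennreal (K * (2 * e i)))"
        using K e(1) by (intro prod.cong refl, subst emeasure_lborel_Ioo)
          (auto simp: algebra_simps intro: less_imp_le)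
      also have "\<dots> = ennreal (\<Prod>i<n. K * (2 * e i))"
        using K e(1) by (intro prod_ennreal) (auto intro: less_imp_le)
      also have "(\<Prod>i<n. K * (2 * e i)) = K ^ n * v"
        by (simp add: v_def prod.distrib)
      finally show ?thesis .
    qed
    then have "measure (lebRn n) ?Q = K ^ n * v"
      using K v by (simp add: measure_def)
    ultimately show ?thesis by simp
  qed
  with v show ?thesis by blast
qed

section \<open>Separated sets of high density\<close>

lemma sqdist_commute: "sqdist n x y = sqdist n y x"
  by (simp add: sqdist_def power2_commute)

text \<open>This replaces the triangle inequality, which fails for squared distances. By the
  parallelogram law the slack in each coordinate is the square of
  \<open>(z i - x i) + (z i - y i)\<close>.\<close>

lemma sqdist_le_double: "sqdist n x y \<le> 2 * sqdist n z x + 2 * sqdist n z y"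
proof -
  have "(x i - y i)\<^sup>2 \<le> 2 * (z i - x i)\<^sup>2 + 2 * (z i - y i)\<^sup>2" for i
    using zero_le_power2[of "(z i - x i) + (z i - y i)"]
    by (simp add: power2_eq_square algebra_simps)
  then show ?thesis
    unfolding sqdist_def sum_distrib_left sum.distrib[symmetric] by (rule sum_mono)
qed

text \<open>Finitely many of the open sets \<open>W z\<close> cover \<open>B\<close>, and each
  contains at most one point of \<open>C\<close>.\<close>

lemma finite_separated_Int_compact:
  assumes "compact B" "d > 0" "pairwise (\<lambda>x y. d < sqdist n x y) C"
  shows "finite (C \<inter> B)"
proof -
  \<comment> \<open>With \<open>d / 4\<close>, two points of \<open>W z\<close> have squared
    distance below \<open>2 * (d / 4) + 2 * (d / 4) = d\<close>.\<close>
  define W where "W z = {y. sqdist n z y < d / 4}" for z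
  have "continuous_on UNIV (sqdist n z)" for z
    unfolding sqdist_def by (intro continuous_intros continuous_coordinate)
  then have opn: "open (W z)" for z
    unfolding W_def by (intro open_Collect_less continuous_on_const)
  have "B \<subseteq> (\<Union>z\<in>B. W z)" using assms(2) by (auto simp: W_def sqdist_def)
  then obtain D where D: "D \<subseteq> B" "finite D" "B \<subseteq> (\<Union>z\<in>D. W z)"
    using compactE_image[OF assms(1), of B W] opn by blast
  have "finite (C \<inter> W z)" for z
  proof -
    have "x = y" if "x \<in> C \<inter> W z" "y \<in> C \<inter> W z" for x y
    proof (rule ccontr)
      assume "x \<noteq> y"
      then have "d < sqdist n x y" using assms(3) that by (auto simp: pairwise_def)
      with sqdist_le_double[of n x y z] that show False by (auto simp: W_def)
    qed
    then show ?thesis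
      by (metis finite.emptyI finite.insertI finite_subset insertCI subsetI all_not_in_conv)
  qed
  then have "finite (\<Union>z\<in>D. C \<inter> W z)" using D(2) by blast
  then show ?thesis by (rule finite_subset[rotated]) (use D(3) in auto)
qed

text \<open>A set of maximal cardinality would be a covering by balls, so a uniform bound below the
  volume ratio is impossible.\<close>
lemma extend_separated:
  assumes "s > 0" "finite F" "F \<subseteq> Rn n" "pairwise (\<lambda>x y. real n * s < sqdist n x y) F"
    and "B \<in> sets (lebRn n)"
  obtains G where "finite G" "F \<subseteq> G" "G \<subseteq> F \<union> B"
    "pairwise (\<lambda>x y. real n * s < sqdist n x y) G"
    "measure (lebRn n) B \<le> real (card G) * sqrt (2 * pi * exp 1 * s) ^ n"
proof (rule ccontr)
  note gen = that
  assume neg: "\<not> thesis"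
  define V where "V = sqrt (2 * pi * exp 1 * s) ^ n"
  have V: "V > 0" using assms(1) by (simp add: V_def)
  have BR: "B \<subseteq> Rn n" using sets.sets_into_space[OF assms(5)] by (simp add: space_lebRn)
  define P where "P G \<longleftrightarrow> finite G \<and> F \<subseteq> G \<and> G \<subseteq> F \<union> B \<and>
    pairwise (\<lambda>x y. real n * s < sqdist n x y) G" for G
  have small: "real (card G) * V < measure (lebRn n) B" if "P G" for G
    using neg gen[of G] that by (fastforce simp: P_def V_def)
  have bnd: "\<forall>G. P G \<longrightarrow> card G \<le> nat \<lfloor>measure (lebRn n) B / V\<rfloor>"
  proof (intro allI impI)
    fix G assume "P G"
    from small[OF this] V have "real (card G) \<le> measure (lebRn n) B / V"
      by (simp add: field_simps)
    then show "card G \<le> nat \<lfloor>measure (lebRn n) B / V\<rfloor>" by linarith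
  qed
  have "P F" using assms by (simp add: P_def)
  then obtain G where G: "P G" "\<And>H. P H \<Longrightarrow> card H \<le> card G"
    using ex_has_greatest_nat[of P F card "Suc (nat \<lfloor>measure (lebRn n) B / V\<rfloor>)"] bnd
    by (auto simp: less_Suc_eq_le)
  let ?ball = "\<lambda>c. {x \<in> Rn n. sqdist n c x \<le> real n * s}"
  have ballm: "?ball c \<in> sets (lebRn n)" for c
    unfolding space_lebRn[symmetric] by measurable
  \<comment> \<open>A point of \<open>B\<close> outside every ball would be far enough from all of
    \<open>G\<close> to be added, against maximality.\<close>
  have "B \<subseteq> (\<Union>c\<in>G. ?ball c)"
  proof
    fix x assume x: "x \<in> B"
    show "x \<in> (\<Union>c\<in>G. ?ball c)"
    proof (rule ccontr)
      assume "x \<notin> (\<Union>c\<in>G. ?ball c)"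
      with x BR have far: "real n * s < sqdist n c x" if "c \<in> G" for c
        using that by (auto simp: not_le)
      have "sqdist n x x \<le> real n * s" using assms(1) by (simp add: sqdist_def)
      with far have "x \<notin> G" by fastforce
      moreover from far have "P (insert x G)"
        using G(1) x by (auto simp: P_def pairwise_insert sqdist_commute[of n x])
      ultimately show False using G(2)[of "insert x G"] G(1) by (auto simp: P_def)
    qed
  qed
  then have "emeasure (lebRn n) B \<le> emeasure (lebRn n) (\<Union>c\<in>G. ?ball c)"
    using ballm G(1) by (intro emeasure_mono) (auto simp: P_def)
  also have "\<dots> \<le> (\<Sum>c\<in>G. emeasure (lebRn n) (?ball c))"
    using ballm G(1) by (intro emeasure_subadditive_finite) (auto simp: P_def)
  also have "\<dots> \<le> (\<Sum>c\<in>G. ennreal V)"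
    unfolding V_def by (intro sum_mono emeasure_ball_le assms)
  also have "\<dots> = ennreal (real (card G) * V)"
    using V by (simp add: ennreal_mult ennreal_of_nat_eq_real_of_nat)
  finally have "measure (lebRn n) B \<le> real (card G) * V"
    unfolding measure_def using V by (intro enn2real_leI) auto
  with small[OF G(1)] show False by simp
qed

text \<open>The code is an increasing union of finite stages; each scale \<^term>\<open>K\<close> is chosen so large that
  the points inherited from the previous stage, which may lie outside the scaled body, are at most
  half of the points needed. A single maximal packing of the whole space would not do, since the
  boundary of \<^term>\<open>B\<close> may have positive measure.\<close>
lemma separated_code_dense_infinitely_often:
  assumes "s > 0" "n > 0" "admissible_shape n B"
  obtains C where "C \<subseteq> Rn n" "pairwise (\<lambda>x y. real n * s < sqdist n x y) C"
    "\<And>K0. \<exists>K\<ge>K0. real (card (C \<inter> scaleRn n K B)) / measure (lebRn n) (scaleRn n K B)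
        \<ge> 1 / (2 * sqrt (2 * pi * exp 1 * s) ^ n)"
proof -
  define V where "V = sqrt (2 * pi * exp 1 * s) ^ n"
  have V: "V > 0" using assms(1) by (simp add: V_def)
  define sep where "sep = pairwise (\<lambda>x y. real n * s < sqdist n x y)"
  define m where "m K = measure (lebRn n) (scaleRn n K B)" for K
  define Q where "Q F K \<longleftrightarrow> m K > 0 \<and> m K / (2 * V) \<le> real (card (F \<inter> scaleRn n K B))" for F K
  from assms(3) have "compact B" by (simp add: admissible_shape_def)
  then have cpt: "compact (scaleRn n K B)" for K by (rule compact_scaleRn)
  obtain v where v: "v > 0" "\<And>K. K > 0 \<Longrightarrow> m K \<ge> K ^ n * v"
    using measure_scaleRn_ge[OF assms(3)] by (auto simp: m_def)
  have step: "\<exists>G K. finite G \<and> G \<subseteq> Rn n \<and> sep G \<and> F \<subseteq> G \<and> real j \<le> K \<and> Q G K"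
    if F: "finite F" "F \<subseteq> Rn n" "sep F" for F j
  proof -
    \<comment> \<open>The last bound, with \<open>K \<le> K ^ n\<close> for
      \<open>K \<ge> 1\<close>, gives \<open>m K \<ge> K * v \<ge> 2 * V * card F\<close>, so
      \<open>F\<close> accounts for at most half of the \<open>m K / V\<close> points;
      \<open>real j\<close> makes the scales unbounded.\<close>
    define K where "K = max (max 1 (real j)) (2 * V * real (card F) / v)"
    have K: "K \<ge> 1" "K \<ge> real j" "K \<ge> 2 * V * real (card F) / v" by (auto simp: K_def)
    have "K * v \<le> K ^ n * v"
      using K(1) assms(2) v(1) by (intro mult_right_mono self_le_power) auto
    also have "\<dots> \<le> m K" using K(1) v(2) by simp
    finally have mK: "K * v \<le> m K" .
    moreover have "K * v > 0" using K(1) v(1) by simp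
    ultimately have mpos: "m K > 0" by linarith
    have "2 * V * real (card F) \<le> m K"
      using K(3) v(1) mK by (simp add: field_simps)
    then have cF: "real (card F) \<le> m K / (2 * V)" using V by (simp add: field_simps)
    obtain G where G: "finite G" "F \<subseteq> G" "G \<subseteq> F \<union> scaleRn n K B" "sep G"
        "m K \<le> real (card G) * V"
      using extend_separated[OF assms(1) F(1,2) F(3)[unfolded sep_def]
          compact_sets_lebRn[OF cpt scaleRn_subset]]
      unfolding m_def V_def sep_def by metis
    \<comment> \<open>Points of \<open>G\<close> outside the scaled body all come from
      \<open>F\<close>, so discarding them costs at most \<open>card F\<close>.\<close>
    have "card G \<le> card (F \<union> (G \<inter> scaleRn n K B))"
      using G F(1) by (intro card_mono) auto
    also have "\<dots> \<le> card F + card (G \<inter> scaleRn n K B)" by (rule card_Un_le)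
    finally have "real (card G) \<le> real (card F) + real (card (G \<inter> scaleRn n K B))" by linarith
    moreover have "m K / V \<le> real (card G)" using G(5) V by (simp add: field_simps)
    moreover have "m K / V = m K / (2 * V) + m K / (2 * V)" by simp
    ultimately have "m K / (2 * V) \<le> real (card (G \<inter> scaleRn n K B))" using cF by linarith
    then show ?thesis
      using G F(2) K(2) mpos scaleRn_subset[of n K B] unfolding Q_def by blast
  qed
  \<comment> \<open>Dependent choice iterates \<open>step\<close>; the density is recorded for
    \<open>f (Suc j)\<close>, since the construction of that stage picks the scale.\<close>
  have "\<exists>f. \<forall>j. (finite (f j) \<and> f j \<subseteq> Rn n \<and> sep (f j)) \<and>
      (f j \<subseteq> f (Suc j) \<and> (\<exists>K\<ge>real j. Q (f (Suc j)) K))"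
  proof (rule dependent_nat_choice)
    show "\<exists>F. finite F \<and> F \<subseteq> Rn n \<and> sep F"
      by (rule exI[of _ "{}"]) (simp add: sep_def)
  qed (use step in meson)
  then obtain f where f: "\<And>j. finite (f j)" "\<And>j. f j \<subseteq> Rn n" "\<And>j. sep (f j)"
      "\<And>j. f j \<subseteq> f (Suc j)" "\<And>j. \<exists>K\<ge>real j. Q (f (Suc j)) K" by blast
  define C where "C = (\<Union>j. f j)"
  have mono: "i \<le> j \<Longrightarrow> f i \<subseteq> f j" for i j
    using lift_Suc_mono_le[of f] f(4) by blast
  have sepC: "sep C"
    unfolding sep_def
  proof (rule pairwiseI)
    fix x y assume "x \<in> C" "y \<in> C" "x \<noteq> y"
    then obtain i j where "x \<in> f i" "y \<in> f j" by (auto simp: C_def)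
    then have "x \<in> f (max i j)" "y \<in> f (max i j)" using mono by (meson max.cobounded1 max.cobounded2 subsetD)+
    then show "real n * s < sqdist n x y"
      using f(3)[of "max i j"] \<open>x \<noteq> y\<close> by (auto simp: sep_def pairwise_def)
  qed
  show thesis
  proof (rule that[of C])
    show "C \<subseteq> Rn n" using f(2) by (auto simp: C_def)
    show "pairwise (\<lambda>x y. real n * s < sqdist n x y) C" using sepC by (simp add: sep_def)
    fix K0 :: real
    obtain j where j: "K0 \<le> real j" using real_arch_simple by blast
    obtain K where K: "K \<ge> real j" "Q (f (Suc j)) K" using f(5) by blast
    \<comment> \<open>Enlarging a stage to \<open>C\<close> cannot lower the count once this
      intersection is finite; an infinite set would have \<open>card\<close> 0.\<close>
    have fin: "finite (C \<inter> scaleRn n K B)"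
      using finite_separated_Int_compact[OF cpt _ sepC[unfolded sep_def]] assms(1,2) by simp
    have "card (f (Suc j) \<inter> scaleRn n K B) \<le> card (C \<inter> scaleRn n K B)"
      using fin by (intro card_mono) (auto simp: C_def)
    with K(2) have "m K / (2 * V) \<le> real (card (C \<inter> scaleRn n K B))" "m K > 0"
      unfolding Q_def by linarith+
    then have "1 / (2 * V) \<le> real (card (C \<inter> scaleRn n K B)) / m K"
      using V by (simp add: field_simps)
    then show "\<exists>K\<ge>K0. real (card (C \<inter> scaleRn n K B)) / measure (lebRn n) (scaleRn n K B)
        \<ge> 1 / (2 * sqrt (2 * pi * exp 1 * s) ^ n)"
      using j K(1) by (intro exI[of _ K]) (auto simp: m_def V_def)
  qed
qed

section \<open>From density to rate and capacity\<close>

text \<open>Every eventual property is compatible with the frequent event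
  \<open>c \<le> f x\<close>, so each supremum in the definition of \<open>Limsup\<close> is at
  least \<open>c\<close>. Density at arbitrarily large scales thus suffices for the rate.\<close>

lemma le_Limsup_frequently:
  fixes f :: "'a \<Rightarrow> 'b::complete_lattice"
  assumes "\<exists>\<^sub>F x in F. c \<le> f x"
  shows "c \<le> Limsup F f"
  unfolding Limsup_def
proof (rule INF_greatest)
  fix P assume "P \<in> {P. eventually P F}"
  then have "\<exists>\<^sub>F x in F. c \<le> f x \<and> P x"
    using assms by (auto intro: frequently_rev_mp elim: eventually_mono)
  then obtain x where "c \<le> f x" "P x" by (auto dest: frequently_ex)
  then show "c \<le> Sup (f ` Collect P)" by (auto intro: SUP_upper2)
qed

text \<open>Taking logarithms of the density \<open>1 / (2 * V ^ n)\<close> and dividing by n yields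
  \<open>- ln V - ln 2 / real n\<close>; the error term stems from the factor 2 lost in the staged
  construction.\<close>

lemma code_rate_sup_ge:
  assumes "N > 0" "L \<ge> 2" "n > 0" "admissible_shape n B"
  shows "(SUP C\<in>{C. avg_rad_list_dec_code n N L C}. code_rate n B C)
     \<ge> ereal (1/2 * ln ((real L - 1) / (4 * pi * exp 1 * real L * N)) - ln 2 / real n)"
proof -
  \<comment> \<open>With this \<open>s\<close> the factor \<open>(L - 1) / (2 * L)\<close> of the
    pairwise estimate turns \<open>n * s\<close> into exactly \<open>n * N\<close>.\<close>
  define s where "s = 2 * real L * N / (real L - 1)"
  define V where "V = sqrt (2 * pi * exp 1 * s)"
  have s: "s > 0" using assms by (simp add: s_def)
  have V: "V > 0" using s by (simp add: V_def)
  obtain C where C: "C \<subseteq> Rn n" "pairwise (\<lambda>x y. real n * s < sqdist n x y) C"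
    "\<And>K0. \<exists>K\<ge>K0. real (card (C \<inter> scaleRn n K B)) / measure (lebRn n) (scaleRn n K B)
        \<ge> 1 / (2 * V ^ n)"
    using separated_code_dense_infinitely_often[OF s assms(3,4)] unfolding V_def by metis
  have "avg_rad_list_dec_code n N L C"
    unfolding avg_rad_list_dec_code_def
  proof (intro conjI allI impI C(1))
    fix S assume S: "S \<subseteq> C \<and> card S = L"
    then have "pairwise (\<lambda>x y. real n * s < sqdist n x y) S"
      using C(2) pairwise_subset by blast
    then have "avg_rad2 n S > (real L - 1) / (2 * real L) * (real n * s)"
      using avg_rad2_gt_of_separated[of S "real n * s" n] S assms(2) by simp
    also have "(real L - 1) / (2 * real L) * (real n * s) = real n * N"
      using assms(2) by (simp add: s_def)
    finally show "avg_rad2 n S > real n * N" .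
  qed
  moreover have "code_rate n B C \<ge> ereal (1 / real n * ln (1 / (2 * V ^ n)))"
    unfolding code_rate_def
  proof (rule le_Limsup_frequently)
    show "\<exists>\<^sub>F K in at_top. ereal (1 / real n * ln (1 / (2 * V ^ n)))
      \<le> ereal (1 / real n) * eln (real (card (C \<inter> scaleRn n K B)) / measure (lebRn n) (scaleRn n K B))"
      unfolding frequently_def eventually_at_top_linorder
    proof
      assume "\<exists>K0. \<forall>K\<ge>K0. \<not> ereal (1 / real n * ln (1 / (2 * V ^ n)))
        \<le> ereal (1 / real n) * eln (real (card (C \<inter> scaleRn n K B)) / measure (lebRn n) (scaleRn n K B))"
      then obtain K0 where K0: "\<And>K. K \<ge> K0 \<Longrightarrow> \<not> ereal (1 / real n * ln (1 / (2 * V ^ n)))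
        \<le> ereal (1 / real n) * eln (real (card (C \<inter> scaleRn n K B)) / measure (lebRn n) (scaleRn n K B))"
        by blast
      obtain K where K: "K \<ge> K0"
        "real (card (C \<inter> scaleRn n K B)) / measure (lebRn n) (scaleRn n K B) \<ge> 1 / (2 * V ^ n)"
        using C(3) by blast
      define q where "q = real (card (C \<inter> scaleRn n K B)) / measure (lebRn n) (scaleRn n K B)"
      \<comment> \<open>Positivity puts the quotient on the \<open>ln\<close> branch of
        \<open>eln\<close>, away from the value \<open>-\<infinity>\<close>.\<close>
      have w: "1 / (2 * V ^ n) > 0" using V by simp
      with K(2) have q: "q > 0" unfolding q_def by linarith
      have "ln (1 / (2 * V ^ n)) \<le> ln q" using K(2) w q by (simp add: q_def)
      then have "1 / real n * ln (1 / (2 * V ^ n)) \<le> 1 / real n * ln q"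
        by (intro mult_left_mono) auto
      then show False using K0[OF K(1)] q by (simp add: q_def[symmetric] eln_def)
    qed
  qed
  moreover have "1 / real n * ln (1 / (2 * V ^ n))
      = 1/2 * ln ((real L - 1) / (4 * pi * exp 1 * real L * N)) - ln 2 / real n"
  proof -
    have "ln (1 / (2 * V ^ n)) = - ln 2 - real n * ln V"
      using V by (simp add: ln_div ln_mult ln_realpow)
    moreover have "ln V = 1/2 * ln (2 * pi * exp 1 * s)"
      using s by (simp add: V_def ln_sqrt)
    moreover have "2 * pi * exp 1 * s = inverse ((real L - 1) / (4 * pi * exp 1 * real L * N))"
      by (simp add: s_def)
    then have "ln (2 * pi * exp 1 * s) = - ln ((real L - 1) / (4 * pi * exp 1 * real L * N))"
      using assms by (simp only: ln_inverse)
    ultimately show ?thesis using assms(3) by (simp add: field_simps)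
  qed
  ultimately show ?thesis by (intro SUP_upper2[of C]) auto
qed

theorem mainTheorem13:
  fixes N :: real and L :: nat and A :: "nat \<Rightarrow> (nat \<Rightarrow> real) set"
  assumes "N > 0" and "L \<ge> 2"
    and "\<And>n. admissible_shape n (A n)"
  shows "avg_list_dec_capacity N L A \<ge>
           ereal (1/2 * ln ((real L - 1) / (4 * pi * exp 1 * real L * N)))"
proof -
  define c where "c = 1/2 * ln ((real L - 1) / (4 * pi * exp 1 * real L * N))"
  \<comment> \<open>The loss \<open>ln 2 / real n\<close> vanishes in the limit, and the estimate
    for n > 0 suffices since \<open>limsup\<close> ignores finitely many dimensions.\<close>
  have "(\<lambda>n. c - ln 2 / real n) \<longlonglongrightarrow> c - 0"
    by (intro tendsto_intros lim_const_over_n)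
  then have "(\<lambda>n. ereal (c - ln 2 / real n)) \<longlonglongrightarrow> ereal c" by simp
  then have "ereal c = limsup (\<lambda>n. ereal (c - ln 2 / real n))"
    by (intro lim_imp_Limsup[symmetric]) auto
  also have "\<dots> \<le> avg_list_dec_capacity N L A"
    unfolding avg_list_dec_capacity_def
  proof (rule Limsup_mono)
    show "\<forall>\<^sub>F n in sequentially. ereal (c - ln 2 / real n)
      \<le> (SUP C\<in>{C. avg_rad_list_dec_code n N L C}. code_rate n (A n) C)"
      using eventually_gt_at_top[of 0]
      by eventually_elim (unfold c_def, rule code_rate_sup_ge[OF assms(1,2) _ assms(3)])
  qed
  finally show ?thesis by (simp add: c_def)
qed

end
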